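(* Let $\delta>0$ and $\gamma\ge 0$, let $G$ be the inverse Gaussian subordinator with parameters $(\delta,\gamma)$, and let $H(t)=\inf\{u>0: G(u)>t\}$. Then, for $t>0$, the distribution of $H(t)$ is not infinitely divisible.
   Context: Let $B$ be a standard Brownian motion. The inverse Gaussian (IG) subordinator with parameters $(\delta,\gamma)$ is $G(t)=\inf\{s>0: B(s)+\gamma s>\delta t\}$; it is a strictly increasing L\'evy process started at $0$ with $\mathbb{E}\,e^{-sG(x)}=e^{-\delta x(\sqrt{\gamma^2+2s}-\gamma)}$ for $s\ge 0$. Its first-exit time process is $H(t)=\inf\{u>0: G(u)>t\}$, $t\ge 0$. *)

theory Defs
  imports "HOL-Probability.Probability"
begin

(* Standard Brownian motion on a probability space M. The process is indexed by the reals, but only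
   times t >= 0 matter. All paths (not just almost all) are continuous, so that path functionals
   such as the hitting times below are measurable without completing M. *)
locale std_brownian_motion = prob_space M for M :: "'a measure" +
  fixes B :: "real \<Rightarrow> 'a \<Rightarrow> real"
  assumes measurable_at: "t \<ge> 0 \<Longrightarrow> B t \<in> borel_measurable M"
    and start_zero: "AE \<omega> in M. B 0 \<omega> = 0"
    and indep_increments:
      "\<lbrakk>0 \<le> \<tau> 0; \<And>i. i < n \<Longrightarrow> \<tau> i \<le> \<tau> (Suc i)\<rbrakk> \<Longrightarrow>
        indep_vars (\<lambda>_. borel) (\<lambda>i \<omega>. B (\<tau> (Suc i)) \<omega> - B (\<tau> i) \<omega>) {..<n::nat}"
    and normal_increments:
      "\<lbrakk>0 \<le> s; s < t\<rbrakk> \<Longrightarrow>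
        distributed M lborel (\<lambda>\<omega>. B t \<omega> - B s \<omega>) (normal_density 0 (sqrt (t - s)))"
    and continuous_paths: "\<omega> \<in> space M \<Longrightarrow> continuous_on {0..} (\<lambda>t. B t \<omega>)"

(* Extended-real valued, so that the infimum is infinite on the paths (a null set under
   std_brownian_motion) that never reach the level. *)
definition IG_subordinator ::
    "(real \<Rightarrow> 'a \<Rightarrow> real) \<Rightarrow> real \<Rightarrow> real \<Rightarrow> real \<Rightarrow> 'a \<Rightarrow> ereal" where
  "IG_subordinator B \<delta> \<gamma> t \<omega> = Inf (ereal ` {s. 0 < s \<and> B s \<omega> + \<gamma> * s > \<delta> * t})"

(* A real infimum; see exit_set_nonempty for why the set is never empty here. *)
definition first_exit_time :: "(real \<Rightarrow> 'a \<Rightarrow> ereal) \<Rightarrow> real \<Rightarrow> 'a \<Rightarrow> real" where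
  "first_exit_time G t \<omega> = Inf {u. 0 < u \<and> G u \<omega> > ereal t}"

primrec convolution_power :: "nat \<Rightarrow> real measure \<Rightarrow> real measure" where
  "convolution_power 0 \<nu> = return borel 0"
| "convolution_power (Suc n) \<nu> = convolution \<nu> (convolution_power n \<nu>)"

definition infinitely_divisible :: "real measure \<Rightarrow> bool" where
  "infinitely_divisible \<mu> \<longleftrightarrow>
    (\<forall>n\<ge>1. \<exists>\<nu>. real_distribution \<nu> \<and> \<mu> = convolution_power n \<nu>)"

lemma IG_subordinator_gt_iff:
  assumes "0 \<le> t" and cont: "continuous_on {0..} (\<lambda>s. B s \<omega>)"
  shows "IG_subordinator B \<delta> \<gamma> u \<omega> > ereal t \<longleftrightarrow>
    (\<exists>r\<in>\<rat>. t < r \<and> (\<forall>s\<in>\<rat>. 0 < s \<and> s < r \<longrightarrow> B s \<omega> + \<gamma> * s \<le> \<delta> * u))"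
    (is "?G > _ \<longleftrightarrow> ?R")
proof
  assume "?G > ereal t"
  then obtain e where e: "ereal t < e" "e < ?G" using dense by blast
  then obtain r' where r': "e = ereal r'" by (cases e) auto
  with e obtain r where r: "r \<in> \<rat>" "t < r" "r < r'" using Rats_dense_in_real by force
  have "B s \<omega> + \<gamma> * s \<le> \<delta> * u" if "0 < s" "s < r" for s
  proof (rule ccontr)
    assume "\<not> ?thesis"
    with that have "?G \<le> ereal s" unfolding IG_subordinator_def by (intro Inf_lower) auto
    also have "ereal s < ereal r'" using that r by simp
    finally show False using e r' by simp
  qed
  with r show ?R by blast
next
  assume ?R
  then obtain r where r: "t < r" and le: "\<And>s. s \<in> \<rat> \<Longrightarrow> 0 < s \<Longrightarrow> s < r \<Longrightarrow> B s \<omega> + \<gamma> * s \<le> \<delta> * u"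
    by blast
  have "ereal r \<le> ?G"
    unfolding IG_subordinator_def
  proof (rule Inf_greatest, clarify)
    fix s assume s: "0 < s" "\<delta> * u < B s \<omega> + \<gamma> * s"
    show "ereal r \<le> ereal s"
    proof (rule ccontr)
      assume "\<not> ?thesis"
      then have sr: "s < r" by simp
      have "continuous_on {0<..<r} (\<lambda>s. B s \<omega> + \<gamma> * s)"
        by (intro continuous_intros continuous_on_subset[OF cont]) auto
      then have "isCont (\<lambda>s. B s \<omega> + \<gamma> * s) s"
        using s sr by (subst (asm) continuous_on_eq_continuous_at) auto
      then have "\<forall>\<^sub>F x in at s. \<delta> * u < B x \<omega> + \<gamma> * x"
        using s order_tendstoD(1) unfolding isCont_def by blast
      then obtain d where d: "d > 0" "\<And>x. x \<noteq> s \<Longrightarrow> dist x s < d \<Longrightarrow> \<delta> * u < B x \<omega> + \<gamma> * x"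
        unfolding eventually_at by auto
      obtain q where "q \<in> \<rat>" "s < q" "q < min r (s + d)"
        using Rats_dense_in_real[of s "min r (s + d)"] sr d by auto
      then show False using le[of q] d(2)[of q] s by (auto simp: dist_real_def)
    qed
  qed
  with r show "?G > ereal t" by (meson less_ereal.simps(1) order_less_le_trans)
qed

lemma IG_subordinator_mono:
  assumes "0 \<le> \<delta>" "u \<le> v"
  shows "IG_subordinator B \<delta> \<gamma> u \<omega> \<le> IG_subordinator B \<delta> \<gamma> v \<omega>"
proof -
  have "\<delta> * u \<le> \<delta> * v" by (rule mult_left_mono[OF assms(2,1)])
  then show ?thesis unfolding IG_subordinator_def by (intro Inf_superset_mono image_mono) auto
qed

lemma exit_set_nonempty:
  assumes "0 < \<delta>" "0 \<le> t" and cont: "continuous_on {0..} (\<lambda>s. B s \<omega>)"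
  shows "{u. 0 < u \<and> IG_subordinator B \<delta> \<gamma> u \<omega> > ereal t} \<noteq> {}"
proof -
  have "continuous_on {0..t+1} (\<lambda>s. B s \<omega> + \<gamma> * s)"
    by (intro continuous_intros continuous_on_subset[OF cont]) auto
  then have "bounded ((\<lambda>s. B s \<omega> + \<gamma> * s) ` {0..t+1})"
    using compact_continuous_image compact_imp_bounded by blast
  then obtain K where K: "\<And>s. 0 \<le> s \<Longrightarrow> s \<le> t + 1 \<Longrightarrow> \<bar>B s \<omega> + \<gamma> * s\<bar> \<le> K" "K > 0"
    unfolding bounded_pos by fastforce
  have "ereal (t + 1) \<le> IG_subordinator B \<delta> \<gamma> (K / \<delta>) \<omega>"
    unfolding IG_subordinator_def
  proof (rule Inf_greatest, clarify)
    fix s assume "0 < s" "\<delta> * (K / \<delta>) < B s \<omega> + \<gamma> * s"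
    then show "ereal (t + 1) \<le> ereal s"
      using K(1)[of s] \<open>0 < \<delta>\<close> by (cases "s \<le> t + 1") auto
  qed
  moreover have "ereal t < ereal (t + 1)" by simp
  ultimately have "ereal t < IG_subordinator B \<delta> \<gamma> (K / \<delta>) \<omega>" by (rule order_less_le_trans[rotated])
  then show ?thesis using K(2) \<open>0 < \<delta>\<close> by (auto intro!: exI[of _ "K / \<delta>"])
qed

(* distr of a non-measurable map is not a probability measure, and its failure to be infinitely
   divisible would be vacuous; this rules that case out. *)
lemma (in std_brownian_motion) borel_measurable_first_exit_time:
  assumes "0 < \<delta>" "0 \<le> t"
  shows "first_exit_time (IG_subordinator B \<delta> \<gamma>) t \<in> borel_measurable M"
proof (rule borel_measurableI_less)
  fix a :: real
  let ?G = "IG_subordinator B \<delta> \<gamma>"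
  have "first_exit_time ?G t \<omega> < a \<longleftrightarrow> (\<exists>u\<in>\<rat>. 0 < u \<and> u < a \<and> ereal t < ?G u \<omega>)"
    if \<omega>: "\<omega> \<in> space M" for \<omega>
  proof -
    have "first_exit_time ?G t \<omega> < a \<longleftrightarrow> (\<exists>u\<in>{u. 0 < u \<and> ?G u \<omega> > ereal t}. u < a)"
      unfolding first_exit_time_def
      by (intro cInf_less_iff exit_set_nonempty assms continuous_paths \<omega> bdd_belowI[of _ 0]) auto
    also have "\<dots> \<longleftrightarrow> (\<exists>u\<in>\<rat>. 0 < u \<and> u < a \<and> ereal t < ?G u \<omega>)"
    proof
      assume "\<exists>u\<in>{u. 0 < u \<and> ?G u \<omega> > ereal t}. u < a"
      then obtain u where u: "0 < u" "ereal t < ?G u \<omega>" "u < a" by auto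
      obtain q where q: "q \<in> \<rat>" "u < q" "q < a" using Rats_dense_in_real u by blast
      have "?G u \<omega> \<le> ?G q \<omega>" using q assms by (intro IG_subordinator_mono) auto
      with u q show "\<exists>u\<in>\<rat>. 0 < u \<and> u < a \<and> ereal t < ?G u \<omega>"
        by (intro bexI[of _ q]) auto
    qed auto
    finally show ?thesis .
  qed
  then have "{\<omega> \<in> space M. first_exit_time ?G t \<omega> < a} =
    {\<omega> \<in> space M. \<exists>u\<in>\<rat>. 0 < u \<and> u < a \<and> (\<exists>r\<in>\<rat>. t < r \<and>
      (\<forall>s\<in>\<rat>. 0 < s \<and> s < r \<longrightarrow> B s \<omega> + \<gamma> * s \<le> \<delta> * u))}"
    by (intro Collect_cong conj_cong refl)
      (simp add: IG_subordinator_gt_iff[where B = B, OF assms(2) continuous_paths])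
  also have "\<dots> \<in> sets M"
  proof -
    have "Measurable.pred M (\<lambda>\<omega>. 0 < s \<and> s < r \<longrightarrow> B s \<omega> + \<gamma> * s \<le> \<delta> * u)" for s r u
    proof (cases "0 < s")
      case True
      then have [measurable]: "B s \<in> borel_measurable M" using measurable_at by auto
      show ?thesis by measurable
    qed simp
    then have "{\<omega> \<in> space M. 0 < s \<and> s < r \<longrightarrow> B s \<omega> + \<gamma> * s \<le> \<delta> * u} \<in> sets M" for s r u
      by (rule predE)
    then show ?thesis
      by (intro sets.sets_Collect_countable_Ex' sets.sets_Collect_countable_All' countable_rat
          sets.sets_Collect_conj sets.sets_Collect_const)
  qed
  finally show "{\<omega> \<in> space M. first_exit_time ?G t \<omega> < a} \<in> sets M" .
qed

end

theory Submission
  imports Defs "HOL-Real_Asymp.Real_Asymp"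
begin

text \<open>
  Up to the factor \<open>\<delta>\<close>, the variable \<open>H(t)\<close> is the maximum of \<open>B s + \<gamma> s\<close> over \<open>s \<le> t\<close>:
  the subordinator has passed \<open>t\<close> at operational time \<open>u\<close> exactly when the drifted path does not
  exceed \<open>\<delta> u\<close> until a little after time \<open>t\<close>. So \<open>H(t)\<close> is nonnegative, it has a Gaussian upper tail, and it is
  not constant. No infinitely divisible law on the half-line has these three properties: if its
  Levy measure is not zero, already the large jumps give a tail of order \<open>exp (- c x ln x)\<close>.

  That last fact has a short proof which needs no Levy-Khinchine representation. Let
  \<open>X = Y\<^sub>1 + \<dots> + Y\<^sub>n\<close> with i.i.d. \<open>Y\<^sub>i \<ge> 0\<close>, and let \<open>Z = exp Y\<^sub>1 - 1 \<ge> 0\<close>. The moment generating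
  function of \<open>Y\<^sub>1\<close> is the \<open>n\<close>-th root of that of \<open>X\<close>, so \<open>n E Z\<close> and \<open>n E Z\<^sup>2\<close> converge as \<open>n\<close> grows,
  to \<open>ln p\<close> and to \<open>V = ln q - 2 ln p\<close>, where \<open>p = E exp X\<close> and \<open>q = E exp (2 X)\<close>. Here \<open>V > 0\<close> because
  \<open>X\<close> is not constant. Third moments are controlled from below by the first two, so \<open>n E Z^3\<close> stays
  above some \<open>c > 0\<close>, and \<open>E exp (3 j Y\<^sub>1) \<ge> 1 + j^3 E Z^3\<close> yields \<open>E exp (3 j X) \<ge> exp (c j^3)\<close> in the
  limit. A Gaussian tail allows only an exponent quadratic in \<open>j\<close>
  (\<open>not_infinitely_divisible_if_mgf_gaussian\<close>).

  The Gaussian tail of the running maximum comes from a Doob type inequality for sums of independent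
  increments (\<open>exponential_maximal_inequality\<close>), applied along dyadic times and carried over to
  continuous time by path continuity (\<open>brownian_maximal_inequality\<close>).
\<close>

section \<open>Convolution powers\<close>

lemma real_distribution_convolution:
  assumes "real_distribution \<mu>" "real_distribution \<nu>"
  shows "real_distribution (convolution \<mu> \<nu>)"
proof -
  interpret \<mu>: real_distribution \<mu> by fact
  interpret \<nu>: real_distribution \<nu> by fact
  interpret pair_prob_space \<mu> \<nu> ..
  have "prob_space (convolution \<mu> \<nu>)"
    unfolding convolution_def by (rule P.prob_space_distr) simp
  then show ?thesis
    by (simp add: real_distribution_def real_distribution_axioms_def)
qed

lemma real_distribution_convolution_power:
  assumes "real_distribution \<nu>"
  shows "real_distribution (convolution_power n \<nu>)"
proof (induction n)
  case 0
  have "prob_space (return borel (0::real))" by (rule prob_space_return) simp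
  then show ?case by (simp add: real_distribution_def real_distribution_axioms_def)
qed (simp add: real_distribution_convolution assms)

lemma nn_integral_exp_convolution_power:
  assumes "real_distribution \<nu>"
  shows "(\<integral>\<^sup>+x. ennreal (exp (\<theta> * x)) \<partial>convolution_power n \<nu>)
    = (\<integral>\<^sup>+x. ennreal (exp (\<theta> * x)) \<partial>\<nu>) ^ n"
proof (induction n)
  case 0
  show ?case by (simp add: nn_integral_return)
next
  case (Suc n)
  interpret \<nu>: real_distribution \<nu> by fact
  interpret \<rho>: real_distribution "convolution_power n \<nu>"
    by (rule real_distribution_convolution_power) fact
  have "(\<integral>\<^sup>+x. ennreal (exp (\<theta> * x)) \<partial>convolution \<nu> (convolution_power n \<nu>))
      = (\<integral>\<^sup>+x. \<integral>\<^sup>+y. ennreal (exp (\<theta> * x)) * ennreal (exp (\<theta> * y))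
          \<partial>convolution_power n \<nu> \<partial>\<nu>)"
    by (subst nn_integral_convolution)
      (auto simp: \<nu>.finite_measure_axioms \<rho>.finite_measure_axioms
        distrib_left exp_add ennreal_mult)
  then show ?case
    by (simp add: nn_integral_cmult nn_integral_multc Suc.IH)
qed

text \<open>
  If all \<open>n\<close> summands are at most \<open>c\<close>, then so is their average.
\<close>

lemma emeasure_atMost_convolution_power:
  assumes "real_distribution \<nu>"
  shows "emeasure \<nu> {..c} ^ n \<le> emeasure (convolution_power n \<nu>) {..real n * c}"
proof (induction n)
  case 0
  show ?case by (simp add: emeasure_return)
next
  case (Suc n)
  interpret \<nu>: real_distribution \<nu> by fact
  interpret \<rho>: real_distribution "convolution_power n \<nu>"
    by (rule real_distribution_convolution_power) fact
  have "emeasure \<nu> {..c} ^ Suc n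
      \<le> emeasure \<nu> {..c} * emeasure (convolution_power n \<nu>) {..real n * c}"
    using Suc by (simp add: mult_left_mono)
  also have "\<dots> = (\<integral>\<^sup>+x. \<integral>\<^sup>+y. indicator {..c} x * indicator {..real n * c} y
      \<partial>convolution_power n \<nu> \<partial>\<nu>)"
    by (simp add: nn_integral_cmult nn_integral_multc)
  also have "\<dots> \<le> (\<integral>\<^sup>+x. \<integral>\<^sup>+y. indicator {..real (Suc n) * c} (x + y)
      \<partial>convolution_power n \<nu> \<partial>\<nu>)"
    by (intro nn_integral_mono) (auto simp: indicator_def algebra_simps)
  also have "\<dots> = emeasure (convolution_power (Suc n) \<nu>) {..real (Suc n) * c}"
    by (simp add: convolution_emeasure' \<nu>.finite_measure_axioms \<rho>.finite_measure_axioms del: of_nat_Suc)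
  finally show ?case .
qed

text \<open>
  If the summands could be negative, then with positive probability all of them would be, and so
  would their sum.
\<close>

lemma AE_nonneg_convolution_root:
  assumes "real_distribution \<nu>" "0 < n" "AE x in convolution_power n \<nu>. 0 \<le> x"
  shows "AE x in \<nu>. 0 \<le> x"
proof -
  interpret \<nu>: real_distribution \<nu> by fact
  interpret \<rho>: real_distribution "convolution_power n \<nu>"
    by (rule real_distribution_convolution_power) fact
  (* The previous lemma concerns closed half-lines; those below the thresholds -1/(m+1) exhaust
     the negative axis. *)
  have "AE x in \<nu>. - inverse (real (Suc m)) < x" for m
  proof -
    define c where "c = - inverse (real (Suc m))"
    have "c < 0" by (simp add: c_def)
    have "real n * c < 0" using \<open>c < 0\<close> \<open>0 < n\<close> by (simp add: mult_pos_neg)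
    with assms(3) have "AE x in convolution_power n \<nu>. x \<notin> {..real n * c}"
      by (auto elim!: eventually_mono)
    then have "emeasure (convolution_power n \<nu>) {..real n * c} = 0"
      by (subst (asm) AE_iff_measurable[OF _ refl]) (auto simp: atMost_def)
    with emeasure_atMost_convolution_power[OF assms(1), of c n]
    have "emeasure \<nu> {..c} = 0" by (simp add: \<open>0 < n\<close>)
    then have "{..c} \<in> null_sets \<nu>" by auto
    from AE_not_in[OF this] show ?thesis unfolding c_def by eventually_elim auto
  qed
  then have "AE x in \<nu>. \<forall>m. - inverse (real (Suc m)) < x" by (simp add: AE_all_countable)
  then show ?thesis
  proof eventually_elim
    case (elim x)
    show "0 \<le> x"
    proof (rule ccontr)
      assume "\<not> 0 \<le> x"
      then obtain m where "inverse (real (Suc m)) < - x" using reals_Archimedean[of "- x"] by auto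
      with elim[rule_format, of m] show False by simp
    qed
  qed
qed

section \<open>Infinitely divisible laws on the half-line\<close>

text \<open>
  The derivative of \<open>p powr h\<close> at \<open>h = 0\<close>, along \<open>h = 1/n\<close>.
\<close>

lemma tendsto_root_log:
  fixes p :: real assumes "p > 0"
  shows "(\<lambda>n. real n * (p powr (1 / real n) - 1)) \<longlonglongrightarrow> ln p"
  using assms by real_asymp

text \<open>
  With \<open>z = exp y - 1\<close> the bracket on the left is \<open>2 b z\<^sup>2 - b\<^sup>2 z\<close>. It is at most \<open>z^3\<close> because
  \<open>z (z - b)\<^sup>2 \<ge> 0\<close>. Bernoulli's inequality for \<open>(1 + z)^j\<close>, cubed, brings in the factor \<open>j^3\<close>. The
  integral of the left side involves only the moment generating function at \<open>1\<close> and \<open>2\<close>.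
\<close>

lemma cubic_lower_bound:
  fixes y b :: real assumes "0 \<le> y"
  shows "1 + real j ^ 3 * (2 * b * (exp (2 * y) - 2 * exp y + 1) - b\<^sup>2 * (exp y - 1))
    \<le> exp (real (3 * j) * y)"
proof -
  define z where "z = exp y - 1"
  have z: "z \<ge> 0" using assms by (simp add: z_def)
  have "z * (z - b)\<^sup>2 \<ge> 0" using z by simp
  then have "2 * b * z\<^sup>2 - b\<^sup>2 * z \<le> z ^ 3"
    by (simp add: power2_eq_square power3_eq_cube algebra_simps)
  then have "1 + real j ^ 3 * (2 * b * z\<^sup>2 - b\<^sup>2 * z) \<le> 1 + (real j * z) ^ 3"
    by (simp add: power_mult_distrib mult_left_mono)
  also have "\<dots> \<le> (1 + real j * z) ^ 3"
    using z by (simp add: power3_eq_cube algebra_simps)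
  also have "\<dots> \<le> ((1 + z) ^ j) ^ 3"
    using z Bernoulli_inequality[of z j] by (intro power_mono) auto
  also have "\<dots> = exp (real (3 * j) * y)"
    by (simp add: z_def flip: power_mult exp_of_nat_mult)
  also have "z\<^sup>2 = exp (2 * y) - 2 * exp y + 1"
    by (simp add: z_def power2_eq_square algebra_simps flip: exp_add)
  finally show ?thesis by (simp add: z_def)
qed

text \<open>
  Moment generating functions of convolution roots are roots of moment generating functions; they are
  finite wherever that of the convolution power is.
\<close>

lemma mgf_convolution_root:
  fixes \<theta> p :: real
  assumes "real_distribution \<nu>" "0 < n" "0 \<le> p"
    and "(\<integral>\<^sup>+x. ennreal (exp (\<theta> * x)) \<partial>convolution_power n \<nu>) = ennreal p"
  shows "integrable \<nu> (\<lambda>x. exp (\<theta> * x))" "(\<integral>x. exp (\<theta> * x) \<partial>\<nu>) ^ n = p"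
proof -
  interpret \<nu>: real_distribution \<nu> by fact
  have pow: "(\<integral>\<^sup>+x. ennreal (exp (\<theta> * x)) \<partial>\<nu>) ^ n = ennreal p"
    using assms(4) nn_integral_exp_convolution_power[OF assms(1)] by simp
  then have "(\<integral>\<^sup>+x. ennreal (exp (\<theta> * x)) \<partial>\<nu>) \<noteq> \<infinity>"
    using \<open>0 < n\<close> by (auto simp: power_eq_top_ennreal_iff)
  then show int: "integrable \<nu> (\<lambda>x. exp (\<theta> * x))"
    by (intro integrableI_nonneg) (auto simp: top.not_eq_extremum)
  have nn: "0 \<le> (\<integral>x. exp (\<theta> * x) \<partial>\<nu>)" by simp
  have "ennreal ((\<integral>x. exp (\<theta> * x) \<partial>\<nu>) ^ n) = ennreal p"
    using pow by (simp add: nn_integral_eq_integral[OF int] ennreal_power)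
  then show "(\<integral>x. exp (\<theta> * x) \<partial>\<nu>) ^ n = p"
    using assms(3) nn by (subst (asm) ennreal_inj) auto
qed

text \<open>
  Infinite divisibility and non-degeneracy force the moment generating function to grow at least like
  \<open>exp (c j^3)\<close> along the multiples \<open>3 j\<close>, which beats every bound with a quadratic exponent.
\<close>

theorem not_infinitely_divisible_if_mgf_gaussian:
  assumes "real_distribution \<mu>" and nonneg: "AE x in \<mu>. 0 \<le> x"
    and mgf: "\<And>k::nat. (\<integral>\<^sup>+x. ennreal (exp (real k * x)) \<partial>\<mu>) \<le> ennreal (exp (K * (1 + real k)\<^sup>2))"
    and nondeg: "\<And>c. \<not> (AE x in \<mu>. x = c)"
  shows "\<not> infinitely_divisible \<mu>"
proof
  assume "infinitely_divisible \<mu>"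
  then have root: "\<exists>\<nu>. real_distribution \<nu> \<and> \<mu> = convolution_power n \<nu>" if "0 < n" for n
    using that by (simp add: infinitely_divisible_def)
  interpret \<mu>: real_distribution \<mu> by fact
  define m where "m k = (\<integral>x. exp (real k * x) \<partial>\<mu>)" for k :: nat
  have int: "integrable \<mu> (\<lambda>x. exp (real k * x))" for k
    using mgf[of k] by (intro integrableI_nonneg) (auto intro: le_less_trans)
  have m_eq: "(\<integral>\<^sup>+x. ennreal (exp (real k * x)) \<partial>\<mu>) = ennreal (m k)" for k
    unfolding m_def by (rule nn_integral_eq_integral[OF int]) simp
  have m_le: "m k \<le> exp (K * (1 + real k)\<^sup>2)" for k
    using mgf[of k] unfolding m_eq by simp
  have m_ge1: "1 \<le> m k" for k
  proof -
    have "(\<integral>x. (1::real) \<partial>\<mu>) \<le> m k"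
      unfolding m_def using nonneg by (intro integral_mono_AE int) (auto elim!: eventually_mono)
    then show ?thesis using \<mu>.prob_space by simp
  qed
  define p q where "p = m 1" and "q = m 2"
  have pq: "1 \<le> p" "1 \<le> q" using m_ge1 by (auto simp: p_def q_def)
  (* The variance of exp X is q - p^2, and it vanishes only if X is constant. *)
  have "p\<^sup>2 < q"
  proof (rule ccontr)
    have i1: "integrable \<mu> (\<lambda>x. exp x)" "integrable \<mu> (\<lambda>x. exp (2 * x))"
      using int[of 1] int[of 2] by auto
    assume "\<not> p\<^sup>2 < q"
    have eq: "(\<lambda>x. (exp x - p)\<^sup>2) = (\<lambda>x. exp (2 * x) - 2 * p * exp x + p\<^sup>2)"
      by (auto simp: power2_eq_square algebra_simps simp flip: exp_add)
    have isq: "integrable \<mu> (\<lambda>x. (exp x - p)\<^sup>2)"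
      unfolding eq using i1 by auto
    have "(\<integral>x. (exp x - p)\<^sup>2 \<partial>\<mu>) = (\<integral>x. exp (2 * x) \<partial>\<mu>) - 2 * p * (\<integral>x. exp x \<partial>\<mu>) + p\<^sup>2"
      unfolding eq using i1 \<mu>.prob_space by simp
    also have "\<dots> = q - p\<^sup>2"
      by (simp add: p_def q_def m_def power2_eq_square)
    finally have sq: "(\<integral>x. (exp x - p)\<^sup>2 \<partial>\<mu>) = q - p\<^sup>2" .
    moreover have "0 \<le> (\<integral>x. (exp x - p)\<^sup>2 \<partial>\<mu>)" by simp
    ultimately have "(\<integral>x. (exp x - p)\<^sup>2 \<partial>\<mu>) = 0" using \<open>\<not> p\<^sup>2 < q\<close> by simp
    then have "AE x in \<mu>. (exp x - p)\<^sup>2 = 0"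
      by (subst (asm) integral_nonneg_eq_0_iff_AE[OF isq]) auto
    then have "AE x in \<mu>. x = ln p"
      by (auto elim!: eventually_mono)
    with nondeg show False by blast
  qed
  define V where "V = ln q - 2 * ln p"
  have "V > 0"
  proof -
    have "2 * ln p = ln (p\<^sup>2)" using pq by (simp add: ln_realpow)
    also have "\<dots> < ln q" using \<open>p\<^sup>2 < q\<close> pq by simp
    finally show ?thesis by (simp add: V_def)
  qed
  (* The limit c of n E (2 b Z^2 - b^2 Z) is positive for small b; the 1 in the denominator
     covers ln p = 0 as well. *)
  define b where "b = V / (ln p + 1)"
  define c where "c = 2 * b * V - b\<^sup>2 * ln p"
  have lnp: "0 \<le> ln p" using pq by simp
  have "b > 0" using \<open>V > 0\<close> lnp by (simp add: b_def)
  have "c > 0"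
  proof -
    have "b * (ln p + 1) = V" using lnp by (simp add: b_def)
    then have "2 * V - b * ln p = V + b" by (simp add: algebra_simps)
    moreover have "c = b * (2 * V - b * ln p)"
      by (simp add: c_def power2_eq_square algebra_simps)
    ultimately show ?thesis using \<open>V > 0\<close> \<open>b > 0\<close> by simp
  qed
  (* x n is n E (2 b Z^2 - b^2 Z), written through the n-th roots of p and q. *)
  define x where "x n = 2 * b * (real n * (q powr (1 / real n) - 1) - 2 * (real n * (p powr (1 / real n) - 1)))
      - b\<^sup>2 * (real n * (p powr (1 / real n) - 1))" for n :: nat
  have "x \<longlonglongrightarrow> 2 * b * (ln q - 2 * ln p) - b\<^sup>2 * ln p"
    unfolding x_def using pq by (intro tendsto_intros tendsto_root_log) auto
  then have "x \<longlonglongrightarrow> c" by (simp add: c_def V_def)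
  (* Integrate the cubic bound against the n-th convolution root and raise it to the power n. *)
  have ge: "(1 + real j ^ 3 * x n / real n) ^ n \<le> m (3 * j)" if xn: "0 \<le> x n" "0 < n" for j n
  proof -
    obtain \<nu> where \<nu>: "real_distribution \<nu>" "\<mu> = convolution_power n \<nu>"
      using root[OF \<open>0 < n\<close>] by blast
    interpret \<nu>: real_distribution \<nu> by fact
    have m_nn: "0 \<le> m k" for k using m_ge1[of k] by simp
    note r = mgf_convolution_root[OF \<nu>(1) \<open>0 < n\<close> m_nn m_eq[unfolded \<nu>(2)]]
    have \<nu>_nonneg: "AE x in \<nu>. 0 \<le> x"
      by (rule AE_nonneg_convolution_root[OF \<nu>(1) \<open>0 < n\<close> nonneg[unfolded \<nu>(2)]])
    define f where "f k = (\<integral>x. exp (real k * x) \<partial>\<nu>)" for k :: nat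
    have f: "integrable \<nu> (\<lambda>x. exp (real k * x))" "f k ^ n = m k" "0 \<le> f k" for k
      unfolding f_def using r by auto
    have f_eq: "f k = m k powr (1 / real n)" for k
    proof -
      have "f k > 0" using f(2)[of k] f(3)[of k] m_ge1[of k] \<open>0 < n\<close>
        by (cases "f k = 0") (auto simp: power_0_left)
      then have "m k = f k powr real n" using f(2) by (simp add: powr_realpow)
      then show ?thesis using \<open>0 < n\<close> \<open>f k > 0\<close> by (simp add: powr_powr)
    qed
    have i1: "integrable \<nu> (\<lambda>x. exp x)" "integrable \<nu> (\<lambda>x. exp (2 * x))"
      using f(1)[of 1] f(1)[of 2] by auto
    have "\<nu>.prob UNIV = 1" using \<nu>.prob_space by simp
    then have "1 + real j ^ 3 * (2 * b * (f 2 - 2 * f 1 + 1) - b\<^sup>2 * (f 1 - 1))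
        = (\<integral>y. 1 + real j ^ 3 * (2 * b * (exp (2 * y) - 2 * exp y + 1) - b\<^sup>2 * (exp y - 1)) \<partial>\<nu>)"
      using i1 by (simp add: f_def)
    also have "\<dots> \<le> f (3 * j)"
      unfolding f_def using \<nu>_nonneg i1
      by (intro integral_mono_AE f(1)) (auto elim!: eventually_mono simp del: of_nat_mult intro: cubic_lower_bound)
    also have "2 * b * (f 2 - 2 * f 1 + 1) - b\<^sup>2 * (f 1 - 1) = x n / real n"
      unfolding x_def f_eq p_def q_def using \<open>0 < n\<close> by (simp add: field_simps)
    finally have "1 + real j ^ 3 * (x n / real n) \<le> f (3 * j)" .
    then have "(1 + real j ^ 3 * (x n / real n)) ^ n \<le> f (3 * j) ^ n"
      using xn by (intro power_mono) auto
    then show ?thesis by (simp add: f(2))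
  qed
  have lower: "exp (real j ^ 3 * (c / 2)) \<le> m (3 * j)" for j
  proof (rule LIMSEQ_le_const2[OF tendsto_exp_limit_sequentially])
    have "\<forall>\<^sub>F n in sequentially. c / 2 < x n"
      using \<open>c > 0\<close> by (intro order_tendstoD(1)[OF \<open>x \<longlonglongrightarrow> c\<close>]) simp
    then obtain N where N: "\<And>n. n \<ge> N \<Longrightarrow> c / 2 < x n"
      unfolding eventually_sequentially by blast
    show "\<exists>N. \<forall>n\<ge>N. (1 + real j ^ 3 * (c / 2) / real n) ^ n \<le> m (3 * j)"
    proof (intro exI[of _ "Suc N"] allI impI)
      fix n assume n: "n \<ge> Suc N"
      have "c / 2 < x n" using N[of n] n by simp
      then have "(1 + real j ^ 3 * (c / 2) / real n) ^ n \<le> (1 + real j ^ 3 * x n / real n) ^ n"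
        using \<open>c > 0\<close> by (intro power_mono add_left_mono divide_right_mono mult_left_mono) auto
      also have "\<dots> \<le> m (3 * j)"
        using \<open>c / 2 < x n\<close> \<open>c > 0\<close> n by (intro ge) auto
      finally show "(1 + real j ^ 3 * (c / 2) / real n) ^ n \<le> m (3 * j)" .
    qed
  qed
  have "real j ^ 3 * (c / 2) \<le> K * (1 + 3 * real j)\<^sup>2" for j
    using order_trans[OF lower m_le, of j] by simp
  moreover have "\<forall>\<^sub>F j in sequentially. K * (1 + 3 * real j)\<^sup>2 < real j ^ 3 * (c / 2)"
    using \<open>c > 0\<close> by real_asymp
  then obtain j :: nat where "K * (1 + 3 * real j)\<^sup>2 < real j ^ 3 * (c / 2)"
    using eventually_happens'[OF sequentially_bot] by blast
  ultimately show False by (meson not_le)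
qed

section \<open>Maximal inequalities\<close>

lemma (in prob_space) indep_var_nn_integral_mult:
  fixes f g :: "'a \<Rightarrow> ennreal"
  assumes "indep_var borel f borel g"
  shows "(\<integral>\<^sup>+\<omega>. f \<omega> * g \<omega> \<partial>M) = (\<integral>\<^sup>+\<omega>. f \<omega> \<partial>M) * (\<integral>\<^sup>+\<omega>. g \<omega> \<partial>M)"
proof -
  have "case_bool borel borel = (\<lambda>_::bool. borel :: ennreal measure)" by (auto simp: fun_eq_iff split: bool.split)
  then have "indep_vars (\<lambda>_. borel) (case_bool f g) UNIV"
    using assms by (simp add: indep_var_def)
  from indep_vars_nn_integral[OF finite this] show ?thesis by (simp add: UNIV_bool mult.commute)
qed

text \<open>
  Stop the walk \<open>S\<close> at its first passage above \<open>x\<close>, and let \<open>F k\<close> be the mean of \<open>exp (\<theta> S)\<close> for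
  the stopped walk at step \<open>k\<close>, with the value after passage lowered to \<open>exp (\<theta> x)\<close>. One step
  multiplies \<open>F\<close> by at most \<open>exp (v k)\<close>, since the next increment is independent of the past. Finally,
  \<open>F n\<close> is at least \<open>exp (\<theta> x)\<close> times the probability of a passage, as in Markov's inequality.
\<close>

lemma (in prob_space) exponential_maximal_inequality:
  fixes X :: "nat \<Rightarrow> 'a \<Rightarrow> real"
  assumes indep: "indep_vars (\<lambda>_. borel) X {..<n}"
    and mgf: "\<And>i. i < n \<Longrightarrow> (\<integral>\<^sup>+\<omega>. ennreal (exp (\<theta> * X i \<omega>)) \<partial>M) \<le> ennreal (exp (v i))"
    and "0 \<le> \<theta>" and v: "\<And>i. i < n \<Longrightarrow> 0 \<le> v i"
  shows "emeasure M {\<omega> \<in> space M. \<exists>k\<le>n. x < (\<Sum>i<k. X i \<omega>)} \<le> ennreal (exp ((\<Sum>i<n. v i) - \<theta> * x))"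
proof -
  have [measurable]: "X i \<in> borel_measurable M" if "i < n" for i
    using indep that by (auto simp: indep_vars_def)
  define S where "S k \<omega> = (\<Sum>i<k. X i \<omega>)" for k \<omega>
  have S_meas[measurable]: "S k \<in> borel_measurable M" if "k \<le> n" for k
    unfolding S_def using that by (intro borel_measurable_sum) auto
  define A where "A k \<omega> \<longleftrightarrow> (\<forall>j\<in>{..k}. S j \<omega> \<le> x)" for k \<omega>
  have A_meas[measurable]: "Measurable.pred M (A k)" if "k \<le> n" for k
  proof -
    have "Measurable.pred M (\<lambda>\<omega>. S j \<omega> \<le> x)" if "j \<le> k" for j
    proof -
      have [measurable]: "S j \<in> borel_measurable M" using that \<open>k \<le> n\<close> by simp
      show ?thesis by measurable
    qed
    then show ?thesis unfolding A_def by (intro pred_intros_finite) auto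
  qed
  define F where "F k = (\<integral>\<^sup>+\<omega>. ennreal (if A k \<omega> then exp (\<theta> * S k \<omega>) else exp (\<theta> * x)) \<partial>M)" for k
  have F_le: "F k \<le> ennreal (exp (\<Sum>i<k. v i))" if "k \<le> n" for k
    using that
  proof (induction k)
    case 0
    have "F 0 \<le> (\<integral>\<^sup>+\<omega>. 1 \<partial>M)"
      unfolding F_def using \<open>0 \<le> \<theta>\<close>
      by (intro nn_integral_mono) (auto simp: S_def A_def mult_nonneg_nonpos not_le)
    then show ?case by (simp add: emeasure_space_1)
  next
    case (Suc k)
    then have "k < n" "k \<le> n" by auto
    note [measurable] = S_meas[OF \<open>k \<le> n\<close>] A_meas[OF \<open>k \<le> n\<close>]
    (* ?f is the contribution of the paths that have not passed x yet, ?g the factor from the next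
       increment, ?h the contribution of the paths that have. *)
    let ?f = "\<lambda>\<omega>. ennreal (if A k \<omega> then exp (\<theta> * S k \<omega>) else 0)"
    let ?g = "\<lambda>\<omega>. ennreal (exp (\<theta> * X k \<omega>))"
    let ?h = "\<lambda>\<omega>. ennreal (if A k \<omega> then 0 else exp (\<theta> * x))"
    have [measurable]: "X k \<in> borel_measurable M" using \<open>k < n\<close> by simp
    have "indep_var borel ?f borel ?g"
    proof -
      (* ?f as a function of the first k increments *)
      let ?P = "\<lambda>u. ennreal (if \<forall>j\<in>{..k}. (\<Sum>i<j. u i) \<le> x then exp (\<theta> * (\<Sum>i<k. u i)) else 0)"
      have Pm: "?P \<in> borel_measurable (\<Pi>\<^sub>M i\<in>{..<k}. borel :: real measure)"
      proof -
        have s: "(\<lambda>u. \<Sum>i<j. u i) \<in> borel_measurable (\<Pi>\<^sub>M i\<in>{..<k}. borel :: real measure)" if "j \<le> k" for j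
          using that by (intro borel_measurable_sum measurable_component_singleton) auto
        have "Measurable.pred (\<Pi>\<^sub>M i\<in>{..<k}. borel :: real measure) (\<lambda>u. (\<Sum>i<j. u i) \<le> x)" if "j \<le> k" for j
          using s[OF that] by measurable
        then have [measurable]: "Measurable.pred (\<Pi>\<^sub>M i\<in>{..<k}. borel :: real measure) (\<lambda>u. \<forall>j\<in>{..k}. (\<Sum>i<j. u i) \<le> x)"
          by (intro pred_intros_finite) auto
        note [measurable] = s[OF order_refl]
        show ?thesis by measurable
      qed
      have Qm: "(\<lambda>u. ennreal (exp (\<theta> * u k))) \<in> borel_measurable (\<Pi>\<^sub>M i\<in>{k}. borel :: real measure)"
        by measurable
      have "indep_var borel (?P \<circ> (\<lambda>\<omega>. restrict (\<lambda>i. X i \<omega>) {..<k}))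
          borel ((\<lambda>u. ennreal (exp (\<theta> * u k))) \<circ> (\<lambda>\<omega>. restrict (\<lambda>i. X i \<omega>) {k}))"
        using \<open>k < n\<close> by (intro indep_var_compose[OF indep_var_restrict[OF indep] Pm Qm]) auto
      also have "?P \<circ> (\<lambda>\<omega>. restrict (\<lambda>i. X i \<omega>) {..<k}) = ?f"
        by (auto simp: fun_eq_iff A_def S_def restrict_def)
      also have "(\<lambda>u. ennreal (exp (\<theta> * u k))) \<circ> (\<lambda>\<omega>. restrict (\<lambda>i. X i \<omega>) {k}) = ?g"
        by (auto simp: fun_eq_iff)
      finally show ?thesis .
    qed
    then have fg: "(\<integral>\<^sup>+\<omega>. ?f \<omega> * ?g \<omega> \<partial>M) = (\<integral>\<^sup>+\<omega>. ?f \<omega> \<partial>M) * (\<integral>\<^sup>+\<omega>. ?g \<omega> \<partial>M)"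
      by (rule indep_var_nn_integral_mult)
    have "F (Suc k) \<le> (\<integral>\<^sup>+\<omega>. ?f \<omega> * ?g \<omega> + ?h \<omega> \<partial>M)"
      unfolding F_def
    proof (intro nn_integral_mono)
      fix \<omega>
      have "S (Suc k) \<omega> = S k \<omega> + X k \<omega>" by (simp add: S_def)
      moreover have "A (Suc k) \<omega> \<longleftrightarrow> A k \<omega> \<and> S (Suc k) \<omega> \<le> x" by (auto simp: A_def le_Suc_eq)
      ultimately show "ennreal (if A (Suc k) \<omega> then exp (\<theta> * S (Suc k) \<omega>) else exp (\<theta> * x)) \<le> ?f \<omega> * ?g \<omega> + ?h \<omega>"
        using \<open>0 \<le> \<theta>\<close> by (auto simp: distrib_left exp_add mult_left_mono simp flip: ennreal_mult
            simp flip: exp_add distrib_left)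
    qed
    also have "\<dots> = (\<integral>\<^sup>+\<omega>. ?f \<omega> \<partial>M) * (\<integral>\<^sup>+\<omega>. ?g \<omega> \<partial>M) + (\<integral>\<^sup>+\<omega>. ?h \<omega> \<partial>M)"
      unfolding fg[symmetric] by (rule nn_integral_add) auto
    also have "\<dots> \<le> (\<integral>\<^sup>+\<omega>. ?f \<omega> \<partial>M) * ennreal (exp (v k)) + (\<integral>\<^sup>+\<omega>. ?h \<omega> \<partial>M) * ennreal (exp (v k))"
    proof (intro add_mono mult_left_mono mgf \<open>k < n\<close>)
      have "1 \<le> ennreal (exp (v k))" using v[OF \<open>k < n\<close>] by simp
      then show "(\<integral>\<^sup>+\<omega>. ?h \<omega> \<partial>M) \<le> (\<integral>\<^sup>+\<omega>. ?h \<omega> \<partial>M) * ennreal (exp (v k))"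
        using mult_left_mono[of 1 _ "\<integral>\<^sup>+\<omega>. ?h \<omega> \<partial>M"] by simp
    qed auto
    also have "\<dots> = F k * ennreal (exp (v k))"
      unfolding F_def distrib_right[symmetric]
      by (subst nn_integral_add[symmetric]) (auto intro!: arg_cong[where f="\<lambda>z. z * _"] nn_integral_cong)
    also have "\<dots> \<le> ennreal (exp (\<Sum>i<k. v i)) * ennreal (exp (v k))"
      using Suc \<open>k \<le> n\<close> by (intro mult_right_mono) auto
    also have "\<dots> = ennreal (exp (\<Sum>i<Suc k. v i))" by (simp add: exp_add ennreal_mult)
    finally show ?case .
  qed
  note [measurable] = A_meas[OF order_refl]
  have "ennreal (exp (\<theta> * x)) * emeasure M {\<omega> \<in> space M. \<not> A n \<omega>}
      = (\<integral>\<^sup>+\<omega>. ennreal (exp (\<theta> * x)) * indicator {\<omega> \<in> space M. \<not> A n \<omega>} \<omega> \<partial>M)"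
    by (rule nn_integral_cmult_indicator[symmetric]) measurable
  also have "\<dots> \<le> F n" unfolding F_def by (intro nn_integral_mono) (auto simp: indicator_def)
  also have "\<dots> \<le> ennreal (exp (\<Sum>i<n. v i))" by (rule F_le) simp
  finally have "ennreal (exp (\<theta> * x)) * emeasure M {\<omega> \<in> space M. \<not> A n \<omega>} \<le> ennreal (exp (\<Sum>i<n. v i))" .
  then have "ennreal (exp (- \<theta> * x)) * (ennreal (exp (\<theta> * x)) * emeasure M {\<omega> \<in> space M. \<not> A n \<omega>})
      \<le> ennreal (exp (- \<theta> * x)) * ennreal (exp (\<Sum>i<n. v i))"
    by (rule mult_left_mono) simp
  moreover have "ennreal (exp (- \<theta> * x)) * ennreal (exp (\<theta> * x)) = 1"
    by (simp flip: ennreal_mult exp_add)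
  ultimately have "emeasure M {\<omega> \<in> space M. \<not> A n \<omega>} \<le> ennreal (exp (- \<theta> * x)) * ennreal (exp (\<Sum>i<n. v i))"
    by (simp add: mult.assoc[symmetric])
  also have "\<dots> = ennreal (exp ((\<Sum>i<n. v i) - \<theta> * x))"
    by (simp add: exp_diff exp_minus divide_inverse mult.commute flip: ennreal_mult)
  also have "{\<omega> \<in> space M. \<not> A n \<omega>} = {\<omega> \<in> space M. \<exists>k\<le>n. x < (\<Sum>i<k. X i \<omega>)}"
    by (auto simp: A_def S_def not_le)
  finally show ?thesis .
qed

text \<open>
  Completing the square turns the tilted density into a multiple of a shifted one.
\<close>

lemma nn_integral_exp_normal:
  assumes "0 < \<sigma>"
  shows "(\<integral>\<^sup>+x. ennreal (exp (\<theta> * x)) * ennreal (normal_density 0 \<sigma> x) \<partial>lborel)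
    = ennreal (exp (\<theta>\<^sup>2 * \<sigma>\<^sup>2 / 2))"
proof -
  have "exp (\<theta> * x) * normal_density 0 \<sigma> x
      = exp (\<theta>\<^sup>2 * \<sigma>\<^sup>2 / 2) * normal_density (\<theta> * \<sigma>\<^sup>2) \<sigma> x" for x
  proof -
    have "\<theta> * x - x\<^sup>2 / (2 * \<sigma>\<^sup>2) = \<theta>\<^sup>2 * \<sigma>\<^sup>2 / 2 - (x - \<theta> * \<sigma>\<^sup>2)\<^sup>2 / (2 * \<sigma>\<^sup>2)"
      using assms by (simp add: field_simps power2_eq_square)
    then have "exp (\<theta> * x) * exp (- (x\<^sup>2 / (2 * \<sigma>\<^sup>2)))
        = exp (\<theta>\<^sup>2 * \<sigma>\<^sup>2 / 2) * exp (- ((x - \<theta> * \<sigma>\<^sup>2)\<^sup>2 / (2 * \<sigma>\<^sup>2)))"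
      by (simp flip: exp_add)
    then show ?thesis unfolding normal_density_def by simp
  qed
  then have "(\<integral>\<^sup>+x. ennreal (exp (\<theta> * x)) * ennreal (normal_density 0 \<sigma> x) \<partial>lborel)
      = (\<integral>\<^sup>+x. ennreal (exp (\<theta>\<^sup>2 * \<sigma>\<^sup>2 / 2)) * ennreal (normal_density (\<theta> * \<sigma>\<^sup>2) \<sigma> x) \<partial>lborel)"
    by (simp flip: ennreal_mult')
  also have "\<dots> = ennreal (exp (\<theta>\<^sup>2 * \<sigma>\<^sup>2 / 2)) * (\<integral>\<^sup>+x. ennreal (normal_density (\<theta> * \<sigma>\<^sup>2) \<sigma> x) \<partial>lborel)"
    by (rule nn_integral_cmult) simp
  also have "(\<integral>\<^sup>+x. ennreal (normal_density (\<theta> * \<sigma>\<^sup>2) \<sigma> x) \<partial>lborel) = 1"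
    using assms by (subst nn_integral_eq_integral) auto
  finally show ?thesis by simp
qed

lemma dyadic_approximation:
  fixes s T d :: real
  assumes "0 < T" "0 \<le> s" "s \<le> T" "0 < d"
  obtains n k :: nat where "k \<le> 2 ^ n" "\<bar>T * real k / 2 ^ n - s\<bar> < d"
proof -
  obtain n :: nat where n: "T / d < 2 ^ n" using real_arch_pow[of 2 "T / d"] by auto
  define k where "k = nat \<lfloor>s * 2 ^ n / T\<rfloor>"
  have nn: "0 \<le> s * 2 ^ n / T" using assms by simp
  have k1: "real k \<le> s * 2 ^ n / T" unfolding k_def using nn by linarith
  have k2: "s * 2 ^ n / T < real k + 1" unfolding k_def using nn by linarith
  have "s * 2 ^ n / T \<le> 2 ^ n" using assms by (simp add: field_simps)
  with k1 have "real k \<le> 2 ^ n" by linarith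
  then have "k \<le> 2 ^ n" by simp
  moreover have "T * real k / 2 ^ n \<le> s" using k1 assms by (simp add: field_simps)
  moreover have "s < T * real k / 2 ^ n + T / 2 ^ n" using k2 assms by (simp add: field_simps)
  moreover have "T / 2 ^ n < d" using n assms by (simp add: field_simps)
  ultimately show ?thesis by (intro that[of k n]) auto
qed

context std_brownian_motion begin

lemma nn_integral_exp_increment:
  assumes "0 \<le> s" "s < t"
  shows "(\<integral>\<^sup>+\<omega>. ennreal (exp (\<theta> * (B t \<omega> - B s \<omega>))) \<partial>M) = ennreal (exp (\<theta>\<^sup>2 * (t - s) / 2))"
proof -
  have "(\<integral>\<^sup>+\<omega>. ennreal (exp (\<theta> * (B t \<omega> - B s \<omega>))) \<partial>M)
      = (\<integral>\<^sup>+x. ennreal (normal_density 0 (sqrt (t - s)) x) * ennreal (exp (\<theta> * x)) \<partial>lborel)"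
    using distributed_nn_integral[OF normal_increments[OF assms], of "\<lambda>x. ennreal (exp (\<theta> * x))"] by simp
  also have "\<dots> = ennreal (exp (\<theta>\<^sup>2 * (t - s) / 2))"
    using nn_integral_exp_normal[of "sqrt (t - s)" \<theta>] assms by (simp add: mult.commute)
  finally show ?thesis .
qed

lemma prob_dyadic_exceed_le:
  assumes "0 < T" "0 \<le> \<theta>"
  shows "emeasure M {\<omega> \<in> space M. \<exists>k\<le>2 ^ n. x < B (T * real k / 2 ^ n) \<omega> - B 0 \<omega>}
    \<le> ennreal (exp (\<theta>\<^sup>2 * T / 2 - \<theta> * x))"
proof -
  define \<tau> where "\<tau> k = T * real k / 2 ^ n" for k :: nat
  have \<tau>: "0 \<le> \<tau> k" "\<tau> k < \<tau> (Suc k)" for k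
    using assms by (auto simp: \<tau>_def divide_strict_right_mono)
  define X where "X i \<omega> = B (\<tau> (Suc i)) \<omega> - B (\<tau> i) \<omega>" for i \<omega>
  define v where "v i = \<theta>\<^sup>2 * (\<tau> (Suc i) - \<tau> i) / 2" for i
  have "indep_vars (\<lambda>_. borel) X {..<2 ^ n}"
    unfolding X_def by (rule indep_increments) (auto intro: \<tau> less_imp_le)
  moreover have "(\<integral>\<^sup>+\<omega>. ennreal (exp (\<theta> * X i \<omega>)) \<partial>M) \<le> ennreal (exp (v i))" for i
    unfolding X_def v_def by (simp add: nn_integral_exp_increment \<tau>)
  moreover have "0 \<le> v i" for i using \<tau>(2)[of i] by (simp add: v_def)
  ultimately have "emeasure M {\<omega> \<in> space M. \<exists>k\<le>2 ^ n. x < (\<Sum>i<k. X i \<omega>)}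
      \<le> ennreal (exp ((\<Sum>i<2 ^ n. v i) - \<theta> * x))"
    using assms by (intro exponential_maximal_inequality)
  also have "(\<Sum>i<2 ^ n. v i) = \<theta>\<^sup>2 * (\<Sum>i<2 ^ n. \<tau> (Suc i) - \<tau> i) / 2"
    unfolding v_def by (simp add: sum_distrib_left sum_divide_distrib)
  also have "\<dots> = \<theta>\<^sup>2 * T / 2"
    by (subst sum_lessThan_telescope) (simp add: \<tau>_def)
  also have "(\<lambda>\<omega> k. \<Sum>i<k. X i \<omega>) = (\<lambda>\<omega> k. B (T * real k / 2 ^ n) \<omega> - B 0 \<omega>)"
    unfolding X_def by (subst sum_lessThan_telescope) (simp add: \<tau>_def)
  finally show ?thesis by (metis (no_types, lifting) Collect_cong)
qed

text \<open>
  The dyadic events increase to an event \<open>E\<close> that obeys the same bound, and by path continuity every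
  path exceeding \<open>x\<close> at some real time already does so at a dyadic one. Working with \<open>E\<close> avoids the
  measurability of the supremum over uncountably many times.
\<close>

lemma brownian_maximal_inequality:
  assumes "0 < T" "0 \<le> \<theta>"
  obtains E where "E \<in> sets M" "emeasure M E \<le> ennreal (exp (\<theta>\<^sup>2 * T / 2 - \<theta> * x))"
    "\<And>\<omega> s. \<omega> \<in> space M \<Longrightarrow> 0 \<le> s \<Longrightarrow> s \<le> T \<Longrightarrow> x < B s \<omega> - B 0 \<omega> \<Longrightarrow> \<omega> \<in> E"
proof -
  define D where "D n = {\<omega> \<in> space M. \<exists>k\<in>{..2 ^ n}. x < B (T * real k / 2 ^ n) \<omega> - B 0 \<omega>}" for n :: nat
  have D_sets: "D n \<in> sets M" for n
  proof -
    have "Measurable.pred M (\<lambda>\<omega>. x < B (T * real k / 2 ^ n) \<omega> - B 0 \<omega>)" for k :: nat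
    proof -
      have [measurable]: "B (T * real k / 2 ^ n) \<in> borel_measurable M" "B 0 \<in> borel_measurable M"
        using assms by (auto intro!: measurable_at)
      show ?thesis by measurable
    qed
    then have "Measurable.pred M (\<lambda>\<omega>. \<exists>k\<in>{..2 ^ n}. x < B (T * real k / 2 ^ n) \<omega> - B 0 \<omega>)"
      by (intro pred_intros_finite) auto
    then show ?thesis unfolding D_def by (rule predE)
  qed
  have "incseq D"
  proof (rule incseq_SucI, rule subsetI)
    fix n \<omega> assume "\<omega> \<in> D n"
    then obtain k where k: "\<omega> \<in> space M" "k \<le> 2 ^ n" "x < B (T * real k / 2 ^ n) \<omega> - B 0 \<omega>"
      by (auto simp: D_def)
    have "T * real (2 * k) / 2 ^ Suc n = T * real k / 2 ^ n" by simp
    with k show "\<omega> \<in> D (Suc n)" unfolding D_def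
      by (intro CollectI conjI bexI[of _ "2 * k"]) (auto simp del: of_nat_mult power_Suc, simp)
  qed
  have le: "emeasure M (D n) \<le> ennreal (exp (\<theta>\<^sup>2 * T / 2 - \<theta> * x))" for n
    using prob_dyadic_exceed_le[OF assms, of n x] by (simp add: D_def Bex_def)
  have "emeasure M (\<Union>n. D n) = (SUP n. emeasure M (D n))"
    using D_sets \<open>incseq D\<close> by (intro SUP_emeasure_incseq[symmetric]) auto
  also have "\<dots> \<le> ennreal (exp (\<theta>\<^sup>2 * T / 2 - \<theta> * x))"
    by (intro SUP_least le)
  finally have "emeasure M (\<Union>n. D n) \<le> ennreal (exp (\<theta>\<^sup>2 * T / 2 - \<theta> * x))" .
  moreover have "\<omega> \<in> (\<Union>n. D n)"
    if s: "\<omega> \<in> space M" "0 \<le> s" "s \<le> T" "x < B s \<omega> - B 0 \<omega>" for \<omega> s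
  proof -
    have "((\<lambda>u. B u \<omega>) \<longlongrightarrow> B s \<omega>) (at s within {0..})"
      using continuous_paths[OF s(1)] s(2) by (simp add: continuous_on_def)
    then have "\<forall>\<^sub>F u in at s within {0..}. x + B 0 \<omega> < B u \<omega>"
      using s(4) by (intro order_tendstoD(1)) auto
    then obtain d where d: "d > 0" "\<And>u. u \<in> {0..} \<Longrightarrow> u \<noteq> s \<Longrightarrow> dist u s < d \<Longrightarrow> x + B 0 \<omega> < B u \<omega>"
      unfolding eventually_at by auto
    obtain n k :: nat where nk: "k \<le> 2 ^ n" "\<bar>T * real k / 2 ^ n - s\<bar> < d"
      using dyadic_approximation[OF \<open>0 < T\<close> s(2,3) d(1)] .
    have "x + B 0 \<omega> < B (T * real k / 2 ^ n) \<omega>"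
      using d(2)[of "T * real k / 2 ^ n"] nk s(4) assms
      by (cases "T * real k / 2 ^ n = s") (auto simp: dist_real_def)
    with nk s(1) show ?thesis by (auto simp: D_def intro!: exI[of _ n] bexI[of _ k])
  qed
  ultimately show ?thesis using D_sets by (intro that[of "\<Union>n. D n"]) auto
qed

lemma brownian_unbounded_above:
  assumes "0 < t"
  shows "\<not> (AE \<omega> in M. B t \<omega> \<le> y)"
proof
  assume "AE \<omega> in M. B t \<omega> \<le> y"
  with start_zero have "AE \<omega> in M. B t \<omega> - B 0 \<omega> \<le> y"
    by eventually_elim simp
  moreover have d: "distributed M lborel (\<lambda>\<omega>. B t \<omega> - B 0 \<omega>) (normal_density 0 (sqrt (t - 0)))"
    by (rule normal_increments) (use assms in auto)
  ultimately have "AE z in distr M lborel (\<lambda>\<omega>. B t \<omega> - B 0 \<omega>). z \<le> y"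
    by (subst AE_distr_iff) (auto dest: distributed_measurable)
  then have "AE z in lborel. 0 < normal_density 0 (sqrt (t - 0)) z \<longrightarrow> z \<le> y"
    unfolding distributed_distr_eq_density[OF d] by (subst (asm) AE_density) auto
  then have "AE z in lborel. z \<notin> {y<..<y+1}"
    by eventually_elim (use assms in \<open>auto simp: normal_density_pos\<close>)
  then have "emeasure lborel {y<..<y+1} = 0"
    by (subst (asm) AE_iff_measurable[OF _ refl]) (auto simp: greaterThanLessThan_def greaterThan_def lessThan_def Int_def)
  then show False by simp
qed

end

section \<open>From tails to moment generating functions\<close>

text \<open>
  On the slab \<open>m < X \<le> m + 1\<close> the integrand is at most \<open>exp (\<theta> (m + 1))\<close>, and the tail bound
  turns the sum over the slabs into a geometric series with ratio \<open>exp (- 1) \<le> 1/2\<close>.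
\<close>

lemma nn_integral_exp_le_of_tail:
  fixes X :: "'a \<Rightarrow> real"
  assumes "prob_space M" and X: "X \<in> borel_measurable M" "\<And>\<omega>. \<omega> \<in> space M \<Longrightarrow> 0 \<le> X \<omega>"
    and tail: "\<And>u. 0 \<le> u \<Longrightarrow> emeasure M {\<omega> \<in> space M. u < X \<omega>} \<le> ennreal (C * exp (- ((\<theta> + 1) * u)))"
    and "0 \<le> \<theta>" "0 \<le> C"
  shows "(\<integral>\<^sup>+\<omega>. ennreal (exp (\<theta> * X \<omega>)) \<partial>M) \<le> ennreal (exp \<theta> * (1 + 2 * C))"
proof -
  interpret prob_space M by fact
  note [measurable] = X(1)
  let ?I = "\<lambda>m \<omega>. indicator {\<omega> \<in> space M. real m < X \<omega>} \<omega> :: ennreal"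
  have pt: "ennreal (exp (\<theta> * X \<omega>)) \<le> ennreal (exp \<theta>) + (\<Sum>m. ennreal (exp (\<theta> * (real m + 1))) * ?I m \<omega>)"
    if "\<omega> \<in> space M" for \<omega>
  proof (cases "X \<omega> = 0")
    case True
    then have "ennreal (exp (\<theta> * X \<omega>)) \<le> ennreal (exp \<theta>)" using \<open>0 \<le> \<theta>\<close> by simp
    also have "\<dots> \<le> ennreal (exp \<theta>) + (\<Sum>m. ennreal (exp (\<theta> * (real m + 1))) * ?I m \<omega>)" by simp
    finally show ?thesis .
  next
    case False
    define m where "m = nat (\<lceil>X \<omega>\<rceil> - 1)"
    have "0 < X \<omega>" using X(2)[OF that] False by simp
    then have m: "real m < X \<omega>" "X \<omega> \<le> real m + 1"
      unfolding m_def by linarith+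
    have "ennreal (exp (\<theta> * X \<omega>)) \<le> ennreal (exp (\<theta> * (real m + 1))) * ?I m \<omega>"
      using m that \<open>0 \<le> \<theta>\<close> by (simp add: mult_left_mono)
    also have "\<dots> \<le> (\<Sum>m. ennreal (exp (\<theta> * (real m + 1))) * ?I m \<omega>)"
    proof -
      define f where "f m = ennreal (exp (\<theta> * (real m + 1))) * ?I m \<omega>" for m
      have "f m \<le> (\<Sum>m. f m)" using sum_le_suminf[of f "{m}"] by simp
      then show ?thesis by (simp add: f_def)
    qed
    also have "\<dots> \<le> ennreal (exp \<theta>) + \<dots>" by simp
    finally show ?thesis .
  qed
  have "exp (-1) \<le> (1 / 2 :: real)" using exp_ge_add_one_self[of 1] by (simp add: exp_minus field_simps)
  then have geo: "(\<lambda>m. exp \<theta> * C * exp (- 1) ^ m) sums (exp \<theta> * C * (1 / (1 - exp (- 1))))"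
    by (intro sums_mult geometric_sums) auto
  have "(\<integral>\<^sup>+\<omega>. ennreal (exp (\<theta> * X \<omega>)) \<partial>M)
      \<le> (\<integral>\<^sup>+\<omega>. ennreal (exp \<theta>) + (\<Sum>m. ennreal (exp (\<theta> * (real m + 1))) * ?I m \<omega>) \<partial>M)"
    by (intro nn_integral_mono pt)
  also have "\<dots> = ennreal (exp \<theta>) + (\<Sum>m. \<integral>\<^sup>+\<omega>. ennreal (exp (\<theta> * (real m + 1))) * ?I m \<omega> \<partial>M)"
    by (subst nn_integral_add, simp, measurable, subst nn_integral_suminf)
      (auto simp: emeasure_space_1)
  also have "(\<Sum>m. \<integral>\<^sup>+\<omega>. ennreal (exp (\<theta> * (real m + 1))) * ?I m \<omega> \<partial>M)
      \<le> (\<Sum>m. ennreal (exp \<theta> * C * exp (- 1) ^ m))"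
  proof (intro suminf_le)
    fix m :: nat
    have "(\<integral>\<^sup>+\<omega>. ennreal (exp (\<theta> * (real m + 1))) * ?I m \<omega> \<partial>M)
        = ennreal (exp (\<theta> * (real m + 1))) * emeasure M {\<omega> \<in> space M. real m < X \<omega>}"
      by (rule nn_integral_cmult_indicator) measurable
    also have "\<dots> \<le> ennreal (exp (\<theta> * (real m + 1))) * ennreal (C * exp (- ((\<theta> + 1) * real m)))"
      by (intro mult_left_mono tail) auto
    also have "\<dots> = ennreal (exp \<theta> * C * exp (- 1) ^ m)"
    proof -
      have "exp (\<theta> * (real m + 1)) * exp (- ((\<theta> + 1) * real m)) = exp \<theta> * exp (- 1) ^ m"
        by (simp add: algebra_simps flip: exp_add exp_of_nat_mult)
      then show ?thesis using \<open>0 \<le> C\<close> by (simp add: mult_ac flip: ennreal_mult)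
    qed
    finally show "(\<integral>\<^sup>+\<omega>. ennreal (exp (\<theta> * (real m + 1))) * ?I m \<omega> \<partial>M)
      \<le> ennreal (exp \<theta> * C * exp (- 1) ^ m)" .
  qed auto
  also have "(\<Sum>m. ennreal (exp \<theta> * C * exp (- 1) ^ m)) = ennreal (exp \<theta> * C * (1 / (1 - exp (- 1))))"
    using \<open>0 \<le> C\<close> geo by (intro suminf_ennreal_eq) auto
  also have "\<dots> \<le> ennreal (exp \<theta> * C * 2)"
    using \<open>exp (-1) \<le> 1 / 2\<close> \<open>0 \<le> C\<close> by (intro ennreal_leI mult_left_mono) (auto simp: field_simps)
  also have "ennreal (exp \<theta>) + \<dots> = ennreal (exp \<theta> * (1 + 2 * C))"
    using \<open>0 \<le> C\<close> by (simp add: algebra_simps flip: ennreal_plus)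
  finally show ?thesis by (simp add: add_left_mono)
qed

section \<open>The first-exit time\<close>

context std_brownian_motion begin

lemma first_exit_time_ge:
  assumes "0 < \<delta>" "0 \<le> t" "\<omega> \<in> space M" "0 < s" "s \<le> t" "\<delta> * u < B s \<omega> + \<gamma> * s"
  shows "u \<le> first_exit_time (IG_subordinator B \<delta> \<gamma>) t \<omega>"
  unfolding first_exit_time_def
proof (rule cInf_greatest[OF exit_set_nonempty])
  fix v assume v: "v \<in> {u. 0 < u \<and> ereal t < IG_subordinator B \<delta> \<gamma> u \<omega>}"
  show "u \<le> v"
  proof (rule ccontr)
    assume "\<not> u \<le> v"
    then have "\<delta> * v < \<delta> * u" using assms by simp
    with assms(6) have "\<delta> * v < B s \<omega> + \<gamma> * s" by linarith
    with assms(4) have "IG_subordinator B \<delta> \<gamma> v \<omega> \<le> ereal s"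
      unfolding IG_subordinator_def by (intro Inf_lower) auto
    also have "\<dots> \<le> ereal t" using assms by simp
    finally show False using v by (auto dest: leD)
  qed
qed (use assms continuous_paths in auto)

lemma first_exit_time_nonneg:
  assumes "0 < \<delta>" "0 \<le> t" "\<omega> \<in> space M"
  shows "0 \<le> first_exit_time (IG_subordinator B \<delta> \<gamma>) t \<omega>"
  unfolding first_exit_time_def
  by (rule cInf_greatest[OF exit_set_nonempty]) (use assms continuous_paths in auto)

text \<open>
  At operational time \<open>u < H(t)\<close> the subordinator is at most \<open>t\<close>. As an infimum it need not be attained,
  so the level \<open>\<delta> u\<close> is certain to be exceeded only slightly after \<open>t\<close>. The horizon \<open>t + 1\<close> leaves room for
  this, and the bounds built on it need no sharp constants.
\<close>

lemma first_exit_time_gtD: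
  assumes "0 < \<delta>" "0 \<le> u" "u < first_exit_time (IG_subordinator B \<delta> \<gamma>) t \<omega>"
  shows "\<exists>s. 0 < s \<and> s < t + 1 \<and> \<delta> * u < B s \<omega> + \<gamma> * s"
proof -
  let ?G = "IG_subordinator B \<delta> \<gamma>"
  obtain v where v: "u < v" "v < first_exit_time ?G t \<omega>" using dense assms(3) by blast
  have "\<not> ereal t < ?G v \<omega>"
  proof
    assume "ereal t < ?G v \<omega>"
    then have "first_exit_time ?G t \<omega> \<le> v"
      unfolding first_exit_time_def using v assms by (intro cInf_lower bdd_belowI[of _ 0]) auto
    with v show False by simp
  qed
  then have "?G v \<omega> \<le> ereal t" by simp
  also have "\<dots> < ereal (t + 1)" by simp
  finally obtain s where "0 < s" "s < t + 1" "\<delta> * v < B s \<omega> + \<gamma> * s"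
    unfolding IG_subordinator_def Inf_less_iff by auto
  moreover have "\<delta> * u < \<delta> * v" using v assms by simp
  ultimately show ?thesis by (intro exI[of _ s]) simp
qed

lemma first_exit_time_tail:
  assumes "0 < \<delta>" "0 \<le> \<gamma>" "0 \<le> t" "0 \<le> u" "0 \<le> \<theta>"
  shows "emeasure M {\<omega> \<in> space M. u < first_exit_time (IG_subordinator B \<delta> \<gamma>) t \<omega>}
    \<le> ennreal (exp (\<theta>\<^sup>2 * (t + 1) / 2 + \<theta> * \<gamma> * (t + 1)) * exp (- (\<theta> * \<delta> * u)))"
proof -
  let ?T = "t + 1" and ?H = "first_exit_time (IG_subordinator B \<delta> \<gamma>) t"
  obtain E where E: "E \<in> sets M"
      "emeasure M E \<le> ennreal (exp (\<theta>\<^sup>2 * ?T / 2 - \<theta> * (\<delta> * u - \<gamma> * ?T)))"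
      "\<And>\<omega> s. \<omega> \<in> space M \<Longrightarrow> 0 \<le> s \<Longrightarrow> s \<le> ?T \<Longrightarrow> \<delta> * u - \<gamma> * ?T < B s \<omega> - B 0 \<omega> \<Longrightarrow> \<omega> \<in> E"
    using brownian_maximal_inequality[of ?T \<theta>] assms by auto
  have "AE \<omega> in M. \<omega> \<in> {\<omega> \<in> space M. u < ?H \<omega>} \<longrightarrow> \<omega> \<in> E"
    using start_zero
  proof eventually_elim
    case (elim \<omega>)
    show ?case
    proof
      assume \<omega>: "\<omega> \<in> {\<omega> \<in> space M. u < ?H \<omega>}"
      then obtain s where s: "0 < s" "s < ?T" "\<delta> * u < B s \<omega> + \<gamma> * s"
        using first_exit_time_gtD[of \<delta> u \<gamma> t \<omega>] assms by auto
      have "\<gamma> * s \<le> \<gamma> * ?T" using s assms by (intro mult_left_mono) auto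
      with s elim have "\<delta> * u - \<gamma> * ?T < B s \<omega> - B 0 \<omega>" by linarith
      with s \<omega> show "\<omega> \<in> E" by (intro E(3)[of \<omega> s]) auto
    qed
  qed
  then have "emeasure M {\<omega> \<in> space M. u < ?H \<omega>} \<le> emeasure M E"
    by (rule emeasure_mono_AE) (rule E)
  also note E(2)
  also have "exp (\<theta>\<^sup>2 * ?T / 2 - \<theta> * (\<delta> * u - \<gamma> * ?T))
      = exp (\<theta>\<^sup>2 * ?T / 2 + \<theta> * \<gamma> * ?T) * exp (- (\<theta> * \<delta> * u))"
    unfolding exp_add[symmetric] by (simp add: algebra_simps)
  finally show ?thesis .
qed

lemma first_exit_time_mgf:
  assumes "0 < \<delta>" "0 \<le> \<gamma>" "0 \<le> t"
  obtains K where "\<And>\<theta>. 0 \<le> \<theta> \<Longrightarrow>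
    (\<integral>\<^sup>+\<omega>. ennreal (exp (\<theta> * first_exit_time (IG_subordinator B \<delta> \<gamma>) t \<omega>)) \<partial>M)
      \<le> ennreal (exp (K * (1 + \<theta>)\<^sup>2))"
proof
  (* The tail bound at parameter (theta + 1) / delta decays like exp (- (theta + 1) u) in u, which
     outweighs exp (theta u); a and b are the coefficients in the exponent of its prefactor. *)
  define a where "a = (t + 1) / (2 * \<delta>\<^sup>2)"
  define b where "b = \<gamma> * (t + 1) / \<delta>"
  have ab: "0 \<le> a" "0 \<le> b" using assms by (auto simp: a_def b_def)
  fix \<theta> :: real assume "0 \<le> \<theta>"
  let ?H = "first_exit_time (IG_subordinator B \<delta> \<gamma>) t"
  define C where "C = exp (a * (1 + \<theta>)\<^sup>2 + b * (1 + \<theta>))"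
  have "(\<integral>\<^sup>+\<omega>. ennreal (exp (\<theta> * ?H \<omega>)) \<partial>M) \<le> ennreal (exp \<theta> * (1 + 2 * C))"
  proof (rule nn_integral_exp_le_of_tail)
    fix u :: real assume "0 \<le> u"
    define \<eta> where "\<eta> = (\<theta> + 1) / \<delta>"
    have "0 \<le> \<eta>" using assms \<open>0 \<le> \<theta>\<close> by (simp add: \<eta>_def)
    moreover have "\<eta> * \<delta> = \<theta> + 1" using assms by (simp add: \<eta>_def)
    moreover have "\<eta>\<^sup>2 * (t + 1) / 2 = a * (1 + \<theta>)\<^sup>2"
      by (simp add: \<eta>_def a_def power_divide add.commute mult.commute)
    moreover have "\<eta> * \<gamma> * (t + 1) = b * (1 + \<theta>)"
      by (simp add: \<eta>_def b_def mult_ac add.commute)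
    ultimately show "emeasure M {\<omega> \<in> space M. u < ?H \<omega>} \<le> ennreal (C * exp (- ((\<theta> + 1) * u)))"
      using first_exit_time_tail[OF assms \<open>0 \<le> u\<close>, of \<eta>] by (simp add: C_def)
  qed (use assms \<open>0 \<le> \<theta>\<close> in \<open>auto simp: C_def prob_space_axioms borel_measurable_first_exit_time
      first_exit_time_nonneg\<close>)
  also have "exp \<theta> * (1 + 2 * C) \<le> exp ((2 + a + b) * (1 + \<theta>)\<^sup>2)"
  proof -
    have "1 \<le> C" using ab \<open>0 \<le> \<theta>\<close> by (simp add: C_def)
    have "1 + \<theta> \<le> (1 + \<theta>)\<^sup>2" using \<open>0 \<le> \<theta>\<close> by (simp add: power2_eq_square algebra_simps)
    then have "b * (1 + \<theta>) \<le> b * (1 + \<theta>)\<^sup>2" "\<theta> + 2 \<le> 2 * (1 + \<theta>)\<^sup>2"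
      using ab \<open>0 \<le> \<theta>\<close> by (auto intro: mult_left_mono)
    then have exponent: "\<theta> + 2 + (a * (1 + \<theta>)\<^sup>2 + b * (1 + \<theta>)) \<le> (2 + a + b) * (1 + \<theta>)\<^sup>2"
      by (simp add: distrib_right)
    have "1 + 2 * C \<le> 3 * C" using \<open>1 \<le> C\<close> by simp
    also have "\<dots> \<le> exp 2 * C"
      using exp_ge_add_one_self[of 2] \<open>1 \<le> C\<close> by (intro mult_right_mono) auto
    finally have "exp \<theta> * (1 + 2 * C) \<le> exp \<theta> * (exp 2 * C)" by simp
    also have "\<dots> = exp (\<theta> + 2 + (a * (1 + \<theta>)\<^sup>2 + b * (1 + \<theta>)))"
      by (simp add: C_def exp_add mult_ac)
    finally show ?thesis using exponent by (meson exp_le_cancel_iff order_trans)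
  qed
  finally show "(\<integral>\<^sup>+\<omega>. ennreal (exp (\<theta> * ?H \<omega>)) \<partial>M) \<le> ennreal (exp ((2 + a + b) * (1 + \<theta>)\<^sup>2))"
    by (simp add: ennreal_leI)
qed

text \<open>
  \<open>B t\<close> exceeds every bound with positive probability, hence so does \<open>H(t)\<close>.
\<close>

lemma first_exit_time_not_AE_const:
  assumes "0 < \<delta>" "0 < t"
  shows "\<not> (AE \<omega> in M. first_exit_time (IG_subordinator B \<delta> \<gamma>) t \<omega> = c)"
proof
  assume "AE \<omega> in M. first_exit_time (IG_subordinator B \<delta> \<gamma>) t \<omega> = c"
  with AE_space have "AE \<omega> in M. B t \<omega> \<le> \<delta> * (c + 1) - \<gamma> * t"
  proof eventually_elim
    case (elim \<omega>)
    then show ?case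
      using first_exit_time_ge[of \<delta> t \<omega> t "c + 1" \<gamma>] assms by (cases "\<delta> * (c + 1) < B t \<omega> + \<gamma> * t") auto
  qed
  then show False using brownian_unbounded_above[OF assms(2)] by blast
qed

end

theorem proposition2p3:
  fixes M :: "'a measure" and B :: "real \<Rightarrow> 'a \<Rightarrow> real" and \<delta> \<gamma> t :: real
  assumes "std_brownian_motion M B"
    and "\<delta> > 0" and "\<gamma> \<ge> 0" and "t > 0"
  shows "\<not> infinitely_divisible (distr M borel (first_exit_time (IG_subordinator B \<delta> \<gamma>) t))"
proof -
  interpret std_brownian_motion M B by fact
  let ?H = "first_exit_time (IG_subordinator B \<delta> \<gamma>) t"
  have t: "0 \<le> t" using assms by simp
  have H[measurable]: "?H \<in> borel_measurable M"
    by (rule borel_measurable_first_exit_time[OF assms(2) t])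
  obtain K where K: "\<And>\<theta>. 0 \<le> \<theta> \<Longrightarrow>
      (\<integral>\<^sup>+\<omega>. ennreal (exp (\<theta> * ?H \<omega>)) \<partial>M) \<le> ennreal (exp (K * (1 + \<theta>)\<^sup>2))"
    using first_exit_time_mgf[OF assms(2,3) t] by blast
  show ?thesis
  proof (rule not_infinitely_divisible_if_mgf_gaussian)
    show "real_distribution (distr M borel ?H)"
      by (rule real_distribution_distr) (rule H)
    show "AE x in distr M borel ?H. 0 \<le> x"
      using first_exit_time_nonneg[OF assms(2) t] by (subst AE_distr_iff) auto
    show "(\<integral>\<^sup>+x. ennreal (exp (real k * x)) \<partial>distr M borel ?H)
        \<le> ennreal (exp (K * (1 + real k)\<^sup>2))" for k :: nat
      using K[of "real k"] by (simp add: nn_integral_distr)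
    show "\<not> (AE x in distr M borel ?H. x = c)" for c
      using first_exit_time_not_AE_const[OF assms(2,4)] by (subst AE_distr_iff) auto
  qed
qed

end
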